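(* Let $A\in\mathbb{C}^{n\times n}$, $D\in\mathbb{C}^{m\times m}$, $B\in\mathbb{C}^{m\times n}$, $C\in\mathbb{C}^{n\times m}$, and put $S=A-CD^{d}B$, $Z=D-BA^{d}C$, $H=BA^{d}$, $K=A^{d}C$, $k=\operatorname{ind}(A)$. If $CD^{d}BA^{\pi}=0$ and $KZ^{\pi}D^{d}H=KZ^{d}D^{\pi}H$, then $$S^{d}=A^{d}+KZ^{d}H+\sum_{i=0}^{k-1}A^{i}A^{\pi}S(A^{d}+KZ^{d}H)^{i+2},$$ or alternatively (the following formula also holds) $$S^{d}=A^{d}+A^{d}CZ^{d}BA^{d}-\sum_{i=0}^{k-1}A^{\pi}A^{i}CZ^{d}BA^{d}(A^{d}+A^{d}CZ^{d}BA^{d})^{i+1}+\sum_{i=0}^{k-1}A^{i}C(D^{\pi}Z^{d}-D^{d}Z^{\pi})BA^{d}(A^{d}+A^{d}CZ^{d}BA^{d})^{i+1}.$$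
   Context: For a square complex matrix $X$, $\operatorname{ind}(X)$ is the smallest non-negative integer $k$ with $\operatorname{rank}(X^{k})=\operatorname{rank}(X^{k+1})$, and the Drazin inverse $X^{d}$ is the unique matrix with $XX^{d}=X^{d}X$, $X^{d}XX^{d}=X^{d}$, $X^{k}=X^{k+1}X^{d}$ for $k=\operatorname{ind}(X)$. Write $X^{\pi}=I-XX^{d}$. Conventions: $X^{0}=I$ for every square matrix $X$, and $\sum_{i=0}^{k}\ast=0$ if $k<0$. *)

theory Defs
  imports "HOL-Analysis.Analysis"
begin

text \<open>On \<^typ>\<open>complex^'n^'n\<close> the class operations \<open>*\<close> and \<open>^\<close> act componentwise, so powers
  with respect to the matrix product \<open>**\<close> are introduced separately.\<close>

primrec mat_pow :: "complex^'n^'n \<Rightarrow> nat \<Rightarrow> complex^'n^'n" where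
  "mat_pow X 0 = mat 1"
| "mat_pow X (Suc i) = X ** mat_pow X i"

definition mat_ind :: "complex^'n^'n \<Rightarrow> nat" where
  "mat_ind X = (LEAST k. rank (mat_pow X k) = rank (mat_pow X (k + 1)))"

definition is_drazin :: "complex^'n^'n \<Rightarrow> complex^'n^'n \<Rightarrow> bool" where
  "is_drazin X Y \<longleftrightarrow>
     X ** Y = Y ** X \<and>
     Y ** X ** Y = Y \<and>
     mat_pow X (mat_ind X) = mat_pow X (mat_ind X + 1) ** Y"

definition drazin :: "complex^'n^'n \<Rightarrow> complex^'n^'n" where
  "drazin X = (THE Y. is_drazin X Y)"

definition drazin_pi :: "complex^'n^'n \<Rightarrow> complex^'n^'n" where
  "drazin_pi X = mat 1 - X ** drazin X"

lemma mat_pow_add: "mat_pow X (i + j) = mat_pow X i ** mat_pow X j"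
  by (induction i) (simp_all add: matrix_mul_assoc)

lemma mat_pow_Suc_right: "mat_pow X (Suc i) = mat_pow X i ** X"
  using mat_pow_add[of X i "Suc 0"] by simp

lemma mat_pow_commute: "X ** Y = Y ** X \<Longrightarrow> mat_pow X i ** Y = Y ** mat_pow X i"
  by (induction i) (simp_all, metis matrix_mul_assoc)

lemma row_matrix_mult:
  fixes M :: "complex^'n^'m" and N :: "complex^'l^'n"
  shows "row i (M ** N) = (\<Sum>j\<in>UNIV. (M $ i $ j) *s row j N)"
  by (simp add: vec_eq_iff row_def matrix_matrix_mult_def)

lemma span_rows_mult_subset:
  fixes P Q :: "complex^'n^'n"
  shows "vec.span (rows (Q ** P)) \<subseteq> vec.span (rows P)"
proof (rule vec.span_minimal)
  have "row i (Q ** P) \<in> vec.span (rows P)" for i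
    unfolding row_matrix_mult
    by (intro vec.span_sum vec.span_scale vec.span_base) (auto simp: rows_def)
  then show "rows (Q ** P) \<subseteq> vec.span (rows P)"
    by (auto simp: rows_def)
qed simp

lemma rank_mult_le:
  fixes P Q :: "complex^'n^'n"
  shows "rank (Q ** P) \<le> rank P"
  using vec.dim_subset[OF span_rows_mult_subset[of Q P]] by (simp add: row_rank_def_gen)

lemma mat_ind_exists: "\<exists>k. rank (mat_pow X k) = rank (mat_pow X (k + 1))"
proof (rule ccontr)
  assume none: "\<nexists>k. rank (mat_pow X k) = rank (mat_pow X (k + 1))"
  have *: "rank (mat_pow X (Suc k)) < rank (mat_pow X k)" for k
  proof -
    from none have "rank (mat_pow X k) \<noteq> rank (mat_pow X (k + 1))"
      by blast
    then show ?thesis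
      using rank_mult_le[of X "mat_pow X k"] by simp
  qed
  have "rank (mat_pow X k) + k \<le> rank (mat_pow X 0)" for k
  proof (induction k)
    case (Suc k)
    then show ?case using *[of k] by linarith
  qed simp
  from this[of "Suc (rank (mat_pow X 0))"] show False by simp
qed

lemma rank_mat_ind: "rank (mat_pow X (mat_ind X)) = rank (mat_pow X (mat_ind X + 1))"
  unfolding mat_ind_def by (rule LeastI_ex) (rule mat_ind_exists)

lemma rank_eq_factor_left:
  fixes P Q :: "complex^'n^'n"
  assumes "rank P = rank (Q ** P)"
  shows "\<exists>W. P = W ** Q ** P"
proof -
  have eq: "vec.span (rows (Q ** P)) = vec.span (rows P)"
    by (rule vec.subspace_dim_equal)
      (use span_rows_mult_subset[of Q P] assms in \<open>auto simp: row_rank_def_gen\<close>)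
  have "\<exists>w. v = (\<Sum>j\<in>UNIV. (w $ j) *s row j (Q ** P))"
    if "v \<in> vec.span (rows (Q ** P))" for v
    using that
  proof (induction rule: vec.span_induct_alt)
    case base
    show ?case by (rule exI[of _ 0]) simp
  next
    case (step c x y)
    then obtain w j where w: "y = (\<Sum>j\<in>UNIV. (w $ j) *s row j (Q ** P))"
      and x: "x = row j (Q ** P)"
      by (auto simp: rows_def)
    have "(\<Sum>i\<in>UNIV. ((w + axis j c) $ i) *s row i (Q ** P))
        = y + (\<Sum>i\<in>UNIV. (if i = j then c *s row i (Q ** P) else 0))"
      unfolding w sum.distrib[symmetric]
      by (rule sum.cong) (auto simp: axis_def vec.scale_left_distrib)
    then show ?case
      by (intro exI[of _ "w + axis j c"]) (simp add: x add.commute)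
  qed
  moreover have "row i P \<in> vec.span (rows (Q ** P))" for i
    unfolding eq by (rule vec.span_base) (auto simp: rows_def)
  ultimately have "\<forall>i. \<exists>w. row i P = (\<Sum>j\<in>UNIV. (w $ j) *s row j (Q ** P))"
    by blast
  from choice[OF this] obtain f where f: "\<forall>i. row i P = (\<Sum>j\<in>UNIV. (f i $ j) *s row j (Q ** P))"
    ..
  have "row i P = row i ((\<chi> i. f i) ** (Q ** P))" for i
    using f by (simp add: row_matrix_mult[of i "\<chi> i. f i"])
  then have "P = (\<chi> i. f i) ** (Q ** P)"
    unfolding row_def vec_eq_iff by simp
  then have "P = (\<chi> i. f i) ** Q ** P"
    unfolding matrix_mul_assoc .
  then show ?thesis ..
qed

lemma square_factor_right:
  fixes a W :: "complex^'n^'n"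
  assumes W: "a = W ** a ** a"
  shows "\<exists>V. a = a ** a ** V"
proof -
  let ?T = "range ((*v) a)"
  have T: "vec.subspace ?T"
    by (metis matrix_vector_mul_linear_gen vec.linear_subspace_image vec.subspace_UNIV)
  have "inj_on ((*v) a) (vec.span ?T)"
    unfolding vec.span_eq_iff[THEN iffD2, OF T]
  proof (rule inj_onI)
    fix x y assume "x \<in> ?T" "y \<in> ?T" "a *v x = a *v y"
    then obtain x' y' where x: "x = a *v x'" "y = a *v y'" "a *v (a *v x') = a *v (a *v y')"
      by auto
    have "a *v z = W *v (a *v (a *v z))" for z
      using W by (metis matrix_vector_mul_assoc)
    then show "x = y" using x by metis
  qed
  then have "vec.dim ((*v) a ` ?T) = vec.dim ?T"
    by (rule vec.dim_image_eq[OF matrix_vector_mul_linear_gen])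
  moreover have "vec.subspace ((*v) a ` ?T)"
    by (rule vec.linear_subspace_image[OF matrix_vector_mul_linear_gen T])
  ultimately have "(*v) a ` ?T = ?T"
    by (intro vec.subspace_dim_equal T) auto
  then have "\<exists>z. a *v x = a *v (a *v z)" for x
    by (metis (mono_tags, lifting) imageE rangeI)
  then obtain f where f: "\<And>x. a *v x = a *v (a *v f x)"
    by metis
  let ?V = "\<chi> i j. f (axis j 1) $ i"
  have col: "column j (M ** N) = M *v column j N" for j and M N :: "complex^'n^'n"
    by (simp add: vec_eq_iff column_def matrix_matrix_mult_def matrix_vector_mult_def)
  have "column j a = column j (a ** a ** ?V)" for j
  proof -
    have "column j ?V = f (axis j 1)"
      by (simp add: column_def vec_eq_iff)
    then have "column j (a ** a ** ?V) = a *v (a *v f (axis j 1))"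
      by (simp add: col matrix_vector_mul_assoc)
    also have "\<dots> = a *v axis j 1" using f by metis
    also have "\<dots> = column j a" by (simp add: matrix_vector_mul_component vec_eq_iff column_def
          matrix_vector_mult_def axis_def if_distrib cong: if_cong)
    finally show ?thesis by simp
  qed
  then have "a = a ** a ** ?V"
    by (simp add: column_def vec_eq_iff)
  then show ?thesis by blast
qed

lemma is_drazin_exists: "\<exists>Y. is_drazin X Y"
proof -
  let ?k = "mat_ind X"
  note assoc = matrix_mul_assoc
  obtain W where W: "mat_pow X ?k = W ** X ** mat_pow X ?k"
    using rank_eq_factor_left[of "mat_pow X ?k" X] rank_mat_ind[of X] by auto
  have Wj: "mat_pow X ?k = mat_pow W j ** mat_pow X (j + ?k)" for j
  proof (induction j)
    case (Suc j)
    have "mat_pow X (?k + j) = W ** X ** mat_pow X ?k ** mat_pow X j"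
      unfolding mat_pow_add by (rule arg_cong2[OF W refl])
    also have "\<dots> = W ** mat_pow X (Suc ?k + j)"
      by (simp add: mat_pow_add assoc)
    finally have "mat_pow X (j + ?k) = W ** mat_pow X (Suc j + ?k)"
      by (simp add: add.commute del: mat_pow.simps)
    then have "mat_pow W j ** mat_pow X (j + ?k) = mat_pow W (Suc j) ** mat_pow X (Suc j + ?k)"
      unfolding mat_pow_Suc_right[of W] by (simp only: assoc)
    with Suc show ?case by (rule trans)
  qed simp
  define a where "a = mat_pow X (Suc ?k)"
  have Xa: "X ** a = a ** X"
    unfolding a_def mat_pow_Suc_right[symmetric] by simp
  define W' where "W' = mat_pow W (Suc ?k)"
  have k_a: "mat_pow X ?k = W' ** a ** mat_pow X ?k"
    using Wj[of "Suc ?k"] unfolding a_def W'_def mat_pow_add assoc .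
  have W': "a = W' ** a ** a"
  proof -
    have "a = mat_pow X ?k ** X"
      by (simp only: a_def mat_pow_Suc_right)
    also have "\<dots> = W' ** a ** mat_pow X ?k ** X"
      by (rule arg_cong[OF k_a])
    also have "\<dots> = W' ** a ** a"
      by (simp only: a_def mat_pow_Suc_right assoc)
    finally show ?thesis .
  qed
  obtain V where V: "a = a ** a ** V"
    using square_factor_right[OF W'] by blast
  define e where "e = a ** V"
  have e: "e = W' ** a" unfolding e_def using V W' by (metis assoc)
  define g where "g = W' ** e"
  have g: "g = e ** V" unfolding g_def e e_def by (metis e e_def assoc)
  have ea: "e ** a = a" "a ** e = a"
    using W' V e e_def by (metis assoc)+
  have ag: "a ** g = e" using g e_def ea by (metis assoc)
  have ga: "g ** a = e" using g_def e ea by (metis assoc)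
  have eg: "e ** g = g" using ag g_def e by (metis assoc)
  have ge: "g ** e = g" using ga g e_def by (metis assoc)
  have "e ** X = e ** X ** e" using ga Xa ea by (metis assoc)
  moreover have "X ** e = e ** X ** e" using ag Xa ea by (metis assoc)
  ultimately have eX: "e ** X = X ** e" by simp
  have gX: "g ** X = X ** g" using ge eg eX ag ga Xa by (metis assoc)
  define Y where "Y = mat_pow X ?k ** g"
  have XY: "X ** Y = e" unfolding Y_def using ag a_def by (simp add: assoc)
  have "mat_pow X ?k ** (g ** X) = X ** mat_pow X ?k ** g"
    unfolding gX by (simp add: assoc mat_pow_commute)
  then have YX: "Y ** X = e"
    using XY by (simp add: Y_def assoc)
  have ep: "mat_pow X ?k ** e = e ** mat_pow X ?k"
    by (rule mat_pow_commute) (simp add: eX)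
  have "e ** Y = mat_pow X ?k ** (e ** g)"
    unfolding Y_def by (simp add: assoc ep)
  then have "Y ** X ** Y = Y"
    unfolding YX eg by (simp add: Y_def)
  moreover have "mat_pow X (?k + 1) ** Y = mat_pow X ?k"
  proof -
    have "mat_pow X (?k + 1) ** Y = mat_pow X ?k ** (X ** Y)"
      by (simp add: mat_pow_Suc_right assoc del: mat_pow.simps)
    also have "\<dots> = W' ** a ** mat_pow X ?k"
      unfolding XY ep by (simp only: e)
    finally show ?thesis using k_a by simp
  qed
  ultimately have "is_drazin X Y" by (simp add: is_drazin_def XY YX)
  then show ?thesis by blast
qed

lemma is_drazin_unique:
  assumes "is_drazin X Y" "is_drazin X Y'"
  shows "Y = Y'"
proof -
  note assoc = matrix_mul_assoc
  let ?k = "mat_ind X"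
  have pow: "\<exists>R. X ** Y = mat_pow X ?k ** R \<and> X ** Y = R ** mat_pow X ?k"
    if "is_drazin X Y" for Y
  proof -
    have c: "X ** Y = Y ** X" and y: "Y ** X ** Y = Y"
      using that unfolding is_drazin_def by blast+
    have "X ** Y = mat_pow X j ** (X ** Y ** mat_pow Y j)" for j
    proof (induction j)
      case (Suc j)
      have "X ** (X ** Y ** (Y ** mat_pow Y j)) = X ** (Y ** X ** Y) ** mat_pow Y j"
        unfolding c[symmetric] by (simp only: assoc)
      then have "X ** (X ** Y ** mat_pow Y (Suc j)) = X ** Y ** mat_pow Y j"
        unfolding y by simp
      then have "mat_pow X j ** (X ** Y ** mat_pow Y j)
          = mat_pow X (Suc j) ** (X ** Y ** mat_pow Y (Suc j))"
        unfolding mat_pow_Suc_right[of X] by (metis assoc)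
      with Suc show ?case by (rule trans)
    qed simp
    moreover have "mat_pow X ?k ** (X ** Y ** mat_pow Y ?k)
        = X ** Y ** mat_pow Y ?k ** mat_pow X ?k"
    proof (rule mat_pow_commute)
      have m: "mat_pow Y ?k ** X = X ** mat_pow Y ?k"
        by (rule mat_pow_commute) (rule c[symmetric])
      have "X ** Y ** mat_pow Y ?k ** X = X ** (Y ** X) ** mat_pow Y ?k"
        by (simp only: assoc[symmetric] m)
      also have "\<dots> = X ** (X ** Y ** mat_pow Y ?k)"
        by (simp only: assoc c[symmetric])
      finally show "X ** (X ** Y ** mat_pow Y ?k) = X ** Y ** mat_pow Y ?k ** X" ..
    qed
    ultimately show ?thesis by metis
  qed
  have absorb: "X ** Y ** (X ** Y') = X ** Y \<and> X ** Y' ** (X ** Y) = X ** Y"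
    if Y: "is_drazin X Y" and Y': "is_drazin X Y'" for Y Y'
  proof -
    have c: "X ** Y' = Y' ** X" and k1: "mat_pow X ?k = mat_pow X (?k + 1) ** Y'"
      using Y' unfolding is_drazin_def by blast+
    have k: "mat_pow X ?k = mat_pow X ?k ** (X ** Y')"
      using k1 unfolding Suc_eq_plus1[symmetric] mat_pow_Suc_right assoc .
    have "mat_pow X ?k ** (X ** Y') = X ** Y' ** mat_pow X ?k"
      by (rule mat_pow_commute) (simp add: c assoc)
    then have k': "mat_pow X ?k = X ** Y' ** mat_pow X ?k"
      by (rule trans[OF k])
    obtain R where R: "X ** Y = mat_pow X ?k ** R" "X ** Y = R ** mat_pow X ?k"
      using pow[OF Y] by blast
    have "X ** Y ** (X ** Y') = R ** (mat_pow X ?k ** (X ** Y'))"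
      unfolding R(2) by (simp only: assoc)
    moreover have "X ** Y' ** (X ** Y) = X ** Y' ** mat_pow X ?k ** R"
      unfolding R(1) by (simp only: assoc)
    ultimately show ?thesis
      unfolding k[symmetric] k'[symmetric] R[symmetric] by simp
  qed
  have eq: "X ** Y = X ** Y'"
    using absorb[OF assms] absorb[OF assms(2,1)] by metis
  have "Y = Y ** (X ** Y)"
    using assms(1) unfolding is_drazin_def assoc by metis
  also have "\<dots> = Y ** X ** Y'"
    unfolding eq assoc ..
  also have "Y ** X = Y' ** X"
    using assms eq unfolding is_drazin_def by metis
  also have "Y' ** X ** Y' = Y'"
    using assms(2) unfolding is_drazin_def by blast
  finally show ?thesis .
qed

lemma is_drazin_drazin: "is_drazin X (drazin X)"
  unfolding drazin_def
  by (rule theI') (use is_drazin_exists is_drazin_unique in blast)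

end

theory Submission
  imports Defs
begin

text \<open>Put \<open>e = A A\<^sup>d\<close>, \<open>p = A\<^sup>\<pi>\<close> and \<open>T = A\<^sup>d + K Z\<^sup>d H\<close>. The first hypothesis gives \<open>S p = A p\<close>, so \<open>S\<close> is
  block triangular with respect to \<open>e + p = I\<close>, with nilpotent block \<open>A p\<close>. The second one gives
  \<open>T S = e\<close>, so \<open>T\<close> is a left inverse of the block \<open>e S e\<close>; by finite dimension it is also a right
  inverse. The first formula is then the Drazin inverse of a triangular block matrix, and
  the second follows by computing \<open>p S T\<close>.\<close>

lemma matrix_add_rdistrib:
  fixes X Y :: "'a::semiring_1^'n^'m" and W :: "'a^'l^'n"
  shows "(X + Y) ** W = X ** W + Y ** W"
  by (simp add: vec_eq_iff matrix_matrix_mult_def distrib_right sum.distrib)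

lemma matrix_mult_diff_left:
  fixes X Y :: "'a::ring_1^'n^'m" and W :: "'a^'l^'n"
  shows "(X - Y) ** W = X ** W - Y ** W"
  by (simp add: vec_eq_iff matrix_matrix_mult_def left_diff_distrib sum_subtractf)

lemma matrix_mult_diff_right:
  fixes X Y :: "'a::ring_1^'l^'n" and W :: "'a^'n^'m"
  shows "W ** (X - Y) = W ** X - W ** Y"
  by (simp add: vec_eq_iff matrix_matrix_mult_def right_diff_distrib sum_subtractf)

lemma matrix_sum_mult:
  fixes f :: "'i \<Rightarrow> 'a::ring_1^'n^'m" and W :: "'a^'l^'n"
  shows "(\<Sum>i\<in>I. f i) ** W = (\<Sum>i\<in>I. f i ** W)"
  by (induction I rule: infinite_finite_induct) (simp_all add: matrix_add_rdistrib)

lemma matrix_mult_sum_distrib: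
  fixes f :: "'i \<Rightarrow> 'a::ring_1^'l^'n" and W :: "'a^'n^'m"
  shows "W ** (\<Sum>i\<in>I. f i) = (\<Sum>i\<in>I. W ** f i)"
  by (induction I rule: infinite_finite_induct) (simp_all add: matrix_add_ldistrib)

lemmas matrix_mult_distribs =
  matrix_add_ldistrib matrix_add_rdistrib matrix_mult_diff_left matrix_mult_diff_right

text \<open>Factor \<open>X^j = X^(j-i) X^i\<close>. This carries identities known at different
  exponents to a common larger one.\<close>

lemma mat_pow_absorb:
  assumes "X ** E = E ** X" and fix_i: "mat_pow X i ** E = mat_pow X i" and "i \<le> j"
  shows "mat_pow X j ** E = mat_pow X j" "E ** mat_pow X j = mat_pow X j"
proof -
  have "mat_pow X j = mat_pow X (j - i) ** mat_pow X i"
    using \<open>i \<le> j\<close> by (simp flip: mat_pow_add)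
  then show *: "mat_pow X j ** E = mat_pow X j"
    using fix_i by (simp flip: matrix_mul_assoc)
  show "E ** mat_pow X j = mat_pow X j"
    using mat_pow_commute[OF assms(1), of j] * by simp
qed

text \<open>\<open>X Y\<close> is idempotent and the two factors commute, so it can be factored
  through an arbitrarily high power of \<open>X\<close>.\<close>

lemma mult_eq_pow_mult_pow:
  assumes c: "X ** Y = Y ** X" and y: "Y ** X ** Y = Y"
  shows "X ** Y = mat_pow X j ** (X ** Y ** mat_pow Y j)"
proof (induction j)
  case (Suc j)
  have "X ** (X ** Y ** mat_pow Y (Suc j)) = X ** Y ** mat_pow Y j"
    by (metis c y mat_pow.simps(2) matrix_mul_assoc)
  with Suc show ?case
    by (metis mat_pow_Suc_right matrix_mul_assoc)
qed simp

text \<open>Any exponent \<open>j\<close> may replace the index, so the index of \<open>X\<close>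
  need not be computed. For large \<open>n\<close> both idempotents \<open>X Y\<close> and
  \<open>X W\<close> factor through \<open>X^n\<close> and fix it, hence they absorb each other and
  coincide; a commuting outer inverse is determined by its idempotent.\<close>

lemma drazin_eqI:
  assumes c: "X ** Y = Y ** X" and y: "Y ** X ** Y = Y"
    and j: "mat_pow X j = mat_pow X (j + 1) ** Y"
  shows "drazin X = Y"
proof -
  note assoc = matrix_mul_assoc
  define W where "W = drazin X"
  define n where "n = max j (mat_ind X)"
  have W: "X ** W = W ** X" "W ** X ** W = W"
    and Wk: "mat_pow X (mat_ind X) = mat_pow X (mat_ind X + 1) ** W"
    using is_drazin_drazin[of X] unfolding is_drazin_def W_def by blast+
  have comm: "X ** (X ** V) = X ** V ** X" if "X ** V = V ** X" for V
    using that by (metis assoc)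
  have "mat_pow X j ** (X ** Y) = mat_pow X j"
    using j[symmetric] by (simp add: mat_pow_Suc_right assoc del: mat_pow.simps)
  then have fixY: "mat_pow X n ** (X ** Y) = mat_pow X n"
    by (rule mat_pow_absorb[OF comm[OF c]]) (simp add: n_def)
  have "mat_pow X (mat_ind X) ** (X ** W) = mat_pow X (mat_ind X)"
    using Wk[symmetric] by (simp add: mat_pow_Suc_right assoc del: mat_pow.simps)
  then have fixW: "X ** W ** mat_pow X n = mat_pow X n"
    by (rule mat_pow_absorb[OF comm[OF W(1)]]) (simp add: n_def)
  have XY: "X ** W ** (X ** Y) = X ** Y"
    by (metis mult_eq_pow_mult_pow[OF c y, of n] fixW assoc)
  have "mat_pow X n ** (X ** W ** mat_pow W n) = X ** W ** mat_pow W n ** mat_pow X n"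
  proof (rule mat_pow_commute)
    have "mat_pow W n ** X = X ** mat_pow W n"
      by (rule mat_pow_commute) (rule W(1)[symmetric])
    then show "X ** (X ** W ** mat_pow W n) = X ** W ** mat_pow W n ** X"
      by (metis W(1) assoc)
  qed
  then have "X ** W ** (X ** Y) = X ** W"
    by (metis mult_eq_pow_mult_pow[OF W, of n] fixY assoc)
  with XY have eq: "X ** Y = X ** W" by simp
  have "Y = X ** W ** Y" using c y eq by metis
  also have "\<dots> = W ** (X ** W)" using W(1) eq by (metis assoc)
  also have "\<dots> = W" using W(2) by (simp add: assoc)
  finally show ?thesis by (simp add: W_def)
qed

text \<open>With respect to \<open>e + p = I\<close>, \<open>S\<close> has an invertible block
  \<open>e S e\<close> with inverse \<open>T\<close>, a nilpotent block \<open>p S p\<close> and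
  zero block \<open>e S p\<close>. The sum is the off-diagonal block of the Drazin inverse.\<close>

lemma drazin_block_triangular:
  fixes S T e :: "complex^'n^'n"
  defines "p \<equiv> mat 1 - e"
  assumes eT: "e ** T = T" and Te: "T ** e = T"
    and TS: "T ** S = e" and eST: "e ** S ** T = e"
    and nil: "mat_pow S k ** p = 0"
  shows "drazin S = T + (\<Sum>i<k. mat_pow S i ** p ** S ** mat_pow T (i + 2))"
proof -
  note assoc = matrix_mul_assoc
  have ee: "e ** e = e" using eT TS by (metis assoc)
  have ep: "e ** p = 0"
    by (simp_all add: p_def matrix_mult_distribs ee)
  \<comment> \<open>The right inverse property forces \<open>e S p = 0\<close>: after inserting
    \<open>e = e S T\<close>, the factor \<open>T S p\<close> equals \<open>e p = 0\<close>.\<close>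
  have "e ** S ** p = e ** S ** T ** S ** p" by (simp add: eST)
  also have "\<dots> = e ** S ** (T ** S ** p)" by (simp add: assoc)
  finally have eSp: "e ** (S ** p) = 0" by (simp add: TS ep assoc)
  have e_pow: "e ** (mat_pow S i ** p) = 0" for i
  proof (induction i)
    case (Suc i)
    have "e ** S = e ** (S ** e)"
      using eSp by (simp add: p_def matrix_mult_distribs)
    then have "e ** (mat_pow S (Suc i) ** p) = e ** S ** (e ** (mat_pow S i ** p))"
      by (simp add: assoc)
    then show ?case by (simp add: Suc)
  qed (simp add: ep)
  define X where "X = (\<Sum>i<k. mat_pow S i ** p ** S ** mat_pow T (i + 2))"
  \<comment> \<open>Both products of \<open>S\<close> with \<open>T + X\<close> will equal
    \<open>e + Q\<close>; \<open>Q\<close> is \<open>X\<close> with one factor \<open>T\<close>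
    fewer.\<close>
  define Q where "Q = (\<Sum>i<k. mat_pow S i ** p ** S ** mat_pow T (i + 1))"
  have powe: "mat_pow T (Suc i) ** e = mat_pow T (Suc i)" for i
    unfolding mat_pow_Suc_right by (simp add: Te flip: assoc)
  have eX: "e ** X = 0" and eQ: "e ** Q = 0"
    unfolding X_def Q_def matrix_mult_sum_distrib
    by (simp_all add: assoc[symmetric] del: mat_pow.simps)
       (simp_all add: assoc e_pow[unfolded assoc] del: mat_pow.simps)
  have Qe: "Q ** e = Q"
    using powe by (simp add: Q_def matrix_sum_mult assoc[symmetric] del: mat_pow.simps)
  have QT: "Q ** T = X"
    by (simp add: Q_def X_def matrix_sum_mult mat_pow_Suc_right assoc del: mat_pow.simps)
  have "mat_pow T (i + 2) ** S = mat_pow T (i + 1)" for i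
    using powe[of i] TS by (simp add: mat_pow_Suc_right[of T "Suc i"] flip: assoc del: mat_pow.simps)
  then have XS: "X ** S = Q"
    by (simp add: Q_def X_def matrix_sum_mult assoc[symmetric] del: mat_pow.simps)
  \<comment> \<open>Index shift: \<open>p S T\<close> is the term \<open>i = 0\<close>, and the
    extra term \<open>i = k\<close> vanishes since \<open>S^k p = 0\<close>.\<close>
  have "p ** S ** T + S ** X = (\<Sum>i<Suc k. mat_pow S i ** p ** S ** mat_pow T (i + 1))"
    unfolding sum.lessThan_Suc_shift
    by (simp add: X_def matrix_mult_sum_distrib assoc)
  then have "p ** S ** T + S ** X = Q"
    using nil by (simp add: Q_def)
  moreover have "S ** T = e + p ** S ** T"
    using eST by (simp add: p_def matrix_mult_distribs)
  ultimately have SY: "S ** (T + X) = e + Q"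
    by (simp add: matrix_add_ldistrib add.assoc)
  have YS: "(T + X) ** S = e + Q"
    by (simp add: matrix_add_rdistrib TS XS)
  have "Q ** X = 0" using Qe eX by (metis assoc times0_right)
  then have YSY: "(T + X) ** S ** (T + X) = T + X"
    unfolding YS by (simp add: matrix_mult_distribs eT eX QT)
  \<comment> \<open>The complementary idempotent has its range inside that of \<open>p\<close>, so
    \<open>S^k\<close> kills it.\<close>
  have "mat 1 - (e + Q) = p ** (mat 1 - (e + Q))"
    by (simp add: p_def matrix_mult_distribs ee eQ)
  then have "mat_pow S k ** (mat 1 - (e + Q)) = 0"
    using nil by (metis assoc times0_left)
  moreover have "mat_pow S (k + 1) ** (T + X) = mat_pow S k ** (e + Q)"
    by (metis SY Suc_eq_plus1 mat_pow_Suc_right assoc)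
  ultimately have "mat_pow S k = mat_pow S (k + 1) ** (T + X)"
    by (simp add: matrix_mult_diff_right del: mat_pow.simps)
  then show ?thesis
    using drazin_eqI[of S "T + X" k] SY YS YSY by (simp add: X_def)
qed

theorem theorem2p8:
  fixes A S :: "complex^'n^'n" and D Z :: "complex^'m^'m"
    and B H :: "complex^'n^'m" and C K :: "complex^'m^'n"
    and k :: nat
  assumes S: "S = A - C ** drazin D ** B"
    and Z: "Z = D - B ** drazin A ** C"
    and H: "H = B ** drazin A"
    and K: "K = drazin A ** C"
    and k: "k = mat_ind A"
    and h1: "C ** drazin D ** B ** drazin_pi A = 0"
    and h2: "K ** drazin_pi Z ** drazin D ** H = K ** drazin Z ** drazin_pi D ** H"
  shows "drazin S =
           drazin A + K ** drazin Z ** H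
           + (\<Sum>i<k. mat_pow A i ** drazin_pi A ** S
                ** mat_pow (drazin A + K ** drazin Z ** H) (i + 2)) \<and>
         drazin S =
           drazin A + drazin A ** C ** drazin Z ** B ** drazin A
           - (\<Sum>i<k. drazin_pi A ** mat_pow A i ** C ** drazin Z ** B ** drazin A
                ** mat_pow (drazin A + drazin A ** C ** drazin Z ** B ** drazin A) (i + 1))
           + (\<Sum>i<k. mat_pow A i ** C
                ** (drazin_pi D ** drazin Z - drazin D ** drazin_pi Z) ** B ** drazin A
                ** mat_pow (drazin A + drazin A ** C ** drazin Z ** B ** drazin A) (i + 1))"
proof -
  note assoc = matrix_mul_assoc
  note assoc_right = matrix_mul_assoc[symmetric]
  define g where "g = drazin A"
  define e where "e = A ** g"
  define p where "p = drazin_pi A"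
  define d where "d = drazin D"
  define z where "z = drazin Z"
  define T where "T = g + K ** z ** H"
  define M where "M = drazin_pi D ** z - d ** drazin_pi Z"
  have T': "T = g + g ** C ** z ** B ** g" by (simp add: T_def H K g_def assoc)
  have p: "p = mat 1 - e" by (simp add: p_def drazin_pi_def e_def g_def)
  have Ag: "A ** g = g ** A" and gAg: "g ** A ** g = g"
    and Ak: "mat_pow A k = mat_pow A (k + 1) ** g"
    using is_drazin_drazin[of A] unfolding is_drazin_def g_def k by blast+
  have eg: "e ** g = g" by (simp add: e_def Ag gAg)
  have ge: "g ** e = g" by (simp add: e_def assoc gAg)
  have gA: "g ** A = e" using Ag e_def by simp
  have eT: "e ** T = T"
    by (simp add: T' matrix_mult_distribs assoc eg)
  have Te: "T ** e = T"
    by (simp add: T' matrix_mult_distribs assoc_right ge)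
  have ee: "e ** e = e" using eg by (metis e_def assoc Ag)
  have Ae: "A ** e = e ** A"
    by (metis Ag e_def assoc)
  have Ap: "A ** p = p ** A"
    by (simp add: p matrix_mult_distribs Ae)
  have Akp: "mat_pow A k ** p = 0"
    using Ak[symmetric] by (simp add: p e_def matrix_mult_distribs mat_pow_Suc_right assoc del: mat_pow.simps)
  have Sp: "S ** p = A ** p"
    using h1 by (simp add: S p_def matrix_mult_distribs)
  have S_pow: "mat_pow S i ** p = mat_pow A i ** p" for i
  proof (induction i)
    case (Suc i)
    have "mat_pow S (Suc i) ** p = S ** (p ** mat_pow A i)"
      using Suc mat_pow_commute[OF Ap, of i] by (simp add: assoc_right)
    also have "\<dots> = A ** (p ** mat_pow A i)" by (simp add: assoc Sp)
    finally show ?case using mat_pow_commute[OF Ap, of i] by (simp add: assoc_right)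
  qed simp
  \<comment> \<open>The definition of \<open>Z\<close> read as \<open>B g C = D - Z\<close>; the
    trailing \<open>V\<close> lets it rewrite inside right-nested products.\<close>
  have BgC: "B ** (g ** (C ** V)) = D ** V - Z ** V" for V :: "complex^'l^'m"
    by (simp add: Z g_def matrix_mult_distribs assoc)
  have "Z ** z = z ** Z" and "D ** d = d ** D"
    using is_drazin_drazin unfolding is_drazin_def z_def d_def by blast+
  then have Zz': "Z ** (z ** V) = z ** (Z ** V)" and Dd': "D ** (d ** V) = d ** (D ** V)"
    for V :: "complex^'n^'m"
    by (simp_all add: assoc)

  \<comment> \<open>Right multiplication by \<open>A\<close> turns \<open>H = B g\<close> into
    \<open>B e\<close>, which gives exactly the defect of \<open>T S\<close> from \<open>e\<close>
    found below.\<close>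
  have "K ** drazin_pi Z ** d ** H ** A = K ** z ** drazin_pi D ** H ** A"
    using h2 by (simp add: d_def z_def)
  then have N: "g ** C ** (z ** drazin_pi D - drazin_pi Z ** d) ** B ** e = 0"
    by (simp add: H K gA assoc_right matrix_mult_distribs flip: g_def)
  have Tp: "T ** p = 0" and ep: "e ** p = 0" and pe: "p ** e = 0" and pp: "p ** p = p"
    by (simp_all add: p matrix_mult_distribs Te ee)
  have "T ** (S ** p) = 0"
    by (simp add: Sp Ap assoc Tp)
  then have "T ** S = T ** S ** e"
    by (simp add: p matrix_mult_distribs assoc)
  also have "\<dots> = e + g ** C ** (z ** drazin_pi D - drazin_pi Z ** d) ** B ** e"
  proof -
    have gA': "g ** (A ** V) = e ** V" for V :: "complex^'n^'n"
      by (simp add: assoc gA)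
    show ?thesis
      unfolding T' S drazin_pi_def
      by (simp add: matrix_mult_distribs assoc_right BgC gA' ee Zz' flip: d_def z_def)
  qed
  finally have TS: "T ** S = e" by (simp add: N)
  \<comment> \<open>Adding \<open>p\<close> extends the one-sided inverse on the range of
    \<open>e\<close> to full square matrices, where left inverses are right inverses.\<close>
  have "(T + p) ** (e ** S + p) = mat 1"
    by (simp add: matrix_mult_distribs assoc Te TS Tp pe pp) (simp add: p)
  then have inv: "(e ** S + p) ** (T + p) = mat 1"
    by (simp add: matrix_left_right_inverse)
  have eST: "e ** S ** T = e"
  proof -
    have "p ** T = 0" by (simp add: p matrix_mult_distribs eT)
    then have "e ** S ** T = (e ** S + p) ** T" by (simp add: matrix_add_rdistrib)
    also have "\<dots> = (e ** S + p) ** ((T + p) ** e)" by (simp add: matrix_add_rdistrib Te pe)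
    finally show ?thesis using inv by (simp add: assoc)
  qed
  have first: "drazin S = T + (\<Sum>i<k. mat_pow A i ** p ** S ** mat_pow T (i + 2))"
    using drazin_block_triangular[of e T S k] eT Te TS eST Akp
    by (simp add: S_pow flip: p)
  have ST: "S ** T = e - p ** C ** z ** B ** g + C ** M ** B ** g"
  proof -
    have AT: "A ** T = e + e ** C ** z ** B ** g"
      by (simp add: T' e_def matrix_mult_distribs assoc)
    have "C ** d ** B ** T = C ** z ** B ** g - C ** M ** B ** g"
      unfolding T' M_def drazin_pi_def
      by (simp add: matrix_mult_distribs assoc_right BgC Dd' flip: d_def z_def)
    with AT show ?thesis
      by (simp add: S p matrix_mult_distribs flip: d_def)
  qed
  \<comment> \<open>Compare \<open>e S T = e\<close> with \<open>e\<close> times the expansion of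
    \<open>S T\<close>. This is why no factor \<open>p\<close> appears in the last sum of the second
    formula.\<close>
  have eCM: "e ** C ** M ** B ** g = 0"
    using eST unfolding assoc_right ST[unfolded assoc_right]
    by (simp add: matrix_mult_distribs assoc ee ep)
  have pST: "p ** (S ** T) = C ** M ** B ** g - p ** C ** z ** B ** g"
  proof -
    have "p ** C ** M ** B ** g = C ** M ** B ** g"
      using eCM by (simp add: p matrix_mult_distribs)
    then show ?thesis
      by (simp add: ST matrix_mult_distribs assoc pe pp)
  qed
  \<comment> \<open>One factor \<open>T\<close> is used up in \<open>p S T\<close>, so the exponent
    drops from \<open>i + 2\<close> to \<open>i + 1\<close>.\<close>
  have "mat_pow A i ** p ** S ** mat_pow T (i + 2)
      = mat_pow A i ** C ** M ** B ** g ** mat_pow T (i + 1)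
        - p ** mat_pow A i ** C ** z ** B ** g ** mat_pow T (i + 1)" for i
  proof -
    have "mat_pow A i ** p ** S ** mat_pow T (i + 2)
        = mat_pow A i ** (p ** (S ** T)) ** mat_pow T (i + 1)"
      by (simp add: assoc)
    then show ?thesis
      unfolding pST using mat_pow_commute[OF Ap, of i]
      by (simp add: matrix_mult_distribs assoc del: mat_pow.simps)
  qed
  then have "(\<Sum>i<k. mat_pow A i ** p ** S ** mat_pow T (i + 2))
      = (\<Sum>i<k. mat_pow A i ** C ** M ** B ** g ** mat_pow T (i + 1))
        - (\<Sum>i<k. p ** mat_pow A i ** C ** z ** B ** g ** mat_pow T (i + 1))"
    by (simp add: sum_subtractf del: mat_pow.simps)
  then have second: "drazin S = T
      - (\<Sum>i<k. p ** mat_pow A i ** C ** z ** B ** g ** mat_pow T (i + 1))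
      + (\<Sum>i<k. mat_pow A i ** C ** M ** B ** g ** mat_pow T (i + 1))"
    by (simp add: first del: mat_pow.simps)
  show ?thesis
    using first[unfolded T_def] second[unfolded T']
    unfolding g_def p_def z_def d_def M_def by blast
qed

end
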